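(* For every $n\ge3$, the complex $\Delta(\Pi_n)/\mathcal{S}_n$ is collapsible.
   Context: Here $\Pi_n$ denotes the poset of all set partitions of $[n]=\{1,\dots,n\}$ ordered by refinement, with the partition into singletons and the one-block partition removed (proper part); $\Delta(\Pi_n)$ is its order complex, i.e. the simplicial complex whose simplices are the finite chains. $\mathcal{S}_n$ acts by permuting $[n]$, and $\Delta(\Pi_n)/\mathcal{S}_n$ is the quotient, a regular CW complex whose cells are simplices, namely the $\mathcal{S}_n$-orbits of chains. A finite regular CW complex is collapsible if it can be reduced to a point by a sequence of elementary collapses. *)

theory Defs
  imports "HOL-Algebra.Sym_Groups" "HOL-Algebra.Group_Action" "HOL-Library.Disjoint_Sets"
begin

section \<open>Finite regular CW complexes and collapsibility\<close>

text \<open>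
  A regular CW complex is given by its (nonempty) open cells, their dimensions, and the closure
  relation: \<open>face K s t\<close> means that the cell \<open>s\<close> is contained in the closure of the cell \<open>t\<close>
  (so it is reflexive on cells). This data determines a regular CW complex up to homeomorphism.
\<close>

record 'c cw_complex =
  cells :: "'c set"
  face :: "'c \<Rightarrow> 'c \<Rightarrow> bool"
  cell_dim :: "'c \<Rightarrow> nat"

definition elementary_collapse :: "'c cw_complex \<Rightarrow> 'c cw_complex \<Rightarrow> bool" where
  "elementary_collapse K L \<longleftrightarrow>
     (\<exists>s\<in>cells K. \<exists>t\<in>cells K.
        face K s t \<and> cell_dim K t = Suc (cell_dim K s) \<and>
        (\<forall>u\<in>cells K. face K s u \<longrightarrow> u = s \<or> u = t) \<and>
        L = K\<lparr>cells := cells K - {s, t}\<rparr>)"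

definition is_point :: "'c cw_complex \<Rightarrow> bool" where
  "is_point K \<longleftrightarrow> (\<exists>v. cells K = {v} \<and> cell_dim K v = 0)"

definition collapsible :: "'c cw_complex \<Rightarrow> bool" where
  "collapsible K \<longleftrightarrow> finite (cells K) \<and> (\<exists>L. elementary_collapse\<^sup>*\<^sup>* K L \<and> is_point L)"

section \<open>Order complexes and their quotients\<close>

text \<open>The empty chain is excluded, since simplices serve as cells.\<close>

definition order_complex :: "'a set \<Rightarrow> ('a \<Rightarrow> 'a \<Rightarrow> bool) \<Rightarrow> 'a set set" where
  "order_complex X R = {C. C \<subseteq> X \<and> finite C \<and> C \<noteq> {} \<and> Complete_Partial_Order.chain R C}"

text \<open>
  The cells of the quotient of a simplicial complex \<open>D\<close> by a group \<open>G\<close> acting on its vertices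
  through \<open>\<phi>\<close> are the orbits of simplices. An orbit lies in the closure of another one if
  representatives can be chosen such that one is a face of the other. All members of an orbit
  have the same number \<open>d + 1\<close> of vertices, \<open>d\<close> being the dimension of the cell. This data
  describes the quotient as a regular CW complex only if no two distinct faces of a simplex
  lie in the same orbit; for partition posets this holds because the action preserves the
  number of blocks, which is injective on chains (see \<open>face_unique\<close> below).
\<close>

definition quotient_complex ::
  "('g, 'b) monoid_scheme \<Rightarrow> ('g \<Rightarrow> 'a \<Rightarrow> 'a) \<Rightarrow> 'a set set \<Rightarrow> 'a set set cw_complex" where
  "quotient_complex G \<phi> D =
     \<lparr> cells = orbits G D (\<lambda>g. image (\<phi> g)),
       face = (\<lambda>s t. \<exists>\<sigma>\<in>s. \<exists>\<tau>\<in>t. \<sigma> \<subseteq> \<tau>),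
       cell_dim = (\<lambda>s. THE d. \<forall>\<sigma>\<in>s. card \<sigma> = Suc d) \<rparr>"

section \<open>The partition poset\<close>

definition proper_partitions :: "nat \<Rightarrow> nat set set set" where
  "proper_partitions n =
     {P. partition_on {1..n} P \<and> P \<noteq> (\<lambda>i. {i}) ` {1..n} \<and> P \<noteq> {{1..n}}}"

definition perm_partition :: "(nat \<Rightarrow> nat) \<Rightarrow> nat set set \<Rightarrow> nat set set" where
  "perm_partition p P = image p ` P"

abbreviation partition_complex :: "nat \<Rightarrow> nat set set set set" where
  "partition_complex n \<equiv> order_complex (proper_partitions n) (refines {1..n})"

abbreviation partition_complex_quotient :: "nat \<Rightarrow> nat set set set set cw_complex" where
  "partition_complex_quotient n \<equiv>
     quotient_complex (sym_group n) perm_partition (partition_complex n)"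

section \<open>Adequacy of the encoding\<close>

lemma inj_image_perm: "p permutes S \<Longrightarrow> inj ((`) p)"
  by (metis inj_image_eq_iff injI permutes_inj)

lemma inj_perm_partition: "p permutes S \<Longrightarrow> inj (perm_partition p)"
  unfolding perm_partition_def by (metis inj_image_eq_iff injI inj_image_perm)

lemma card_perm_partition:
  assumes "p permutes S"
  shows "card (perm_partition p P) = card P"
proof -
  have "inj ((`) p)"
    using assms by (rule inj_image_perm)
  then show ?thesis
    unfolding perm_partition_def by (metis card_image inj_on_subset subset_UNIV)
qed

lemma refines_card_eq:
  assumes fin: "finite A" and ref: "refines A P Q" and card: "card P = card Q"
  shows "P = Q"
proof -
  have P: "partition_on A P" and Q: "partition_on A Q"
    and sub: "\<forall>X\<in>P. \<exists>Y\<in>Q. X \<subseteq> Y"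
    using ref by (auto simp: refines_def)
  obtain f where f: "\<And>X. X \<in> P \<Longrightarrow> f X \<in> Q \<and> X \<subseteq> f X"
    using sub by metis
  have finP: "finite P" and finQ: "finite Q"
    using P Q fin finite_elements by blast+
  have disjQ: "Y = Z" if "Y \<in> Q" "Z \<in> Q" "y \<in> Y" "y \<in> Z" for Y Z y
    using that Q by (meson disjoint_iff partition_onD2 disjointD)
  have surj: "Q = f ` P"
  proof
    show "f ` P \<subseteq> Q" using f by auto
    show "Q \<subseteq> f ` P"
    proof
      fix Y assume Y: "Y \<in> Q"
      then obtain y where y: "y \<in> Y"
        using partition_onD3[OF Q] by (metis all_not_in_conv)
      then obtain X where X: "X \<in> P" "y \<in> X"
        using Y partition_onD1[OF P] partition_onD1[OF Q] by auto
      then have "f X = Y" using f disjQ Y y by blast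
      then show "Y \<in> f ` P" using X by blast
    qed
  qed
  then have inj: "inj_on f P"
    using card finP eq_card_imp_inj_on by metis
  have fixed: "f X = X" if X: "X \<in> P" for X
  proof
    show "X \<subseteq> f X" using f X by blast
    show "f X \<subseteq> X"
    proof
      fix y assume y: "y \<in> f X"
      then obtain X' where X': "X' \<in> P" "y \<in> X'"
        using f[OF X] partition_onD1[OF P] partition_onD1[OF Q] by auto
      then have "f X' = f X" using f disjQ X y by blast
      then show "y \<in> X" using inj X X' by (metis inj_onD)
    qed
  qed
  then show ?thesis using surj by simp
qed

lemma face_unique:
  assumes \<tau>: "\<tau> \<in> partition_complex n"
    and sub: "\<sigma> \<subseteq> \<tau>" "\<sigma>' \<subseteq> \<tau>"
    and p: "p \<in> carrier (sym_group n)" "perm_partition p ` \<sigma> = \<sigma>'"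
  shows "\<sigma> = \<sigma>'"
proof -
  have "perm_partition p P = P" if P: "P \<in> \<sigma>" for P
  proof -
    have "perm_partition p P \<in> \<tau>" "P \<in> \<tau>" using P sub p by auto
    then have "refines {1..n} P (perm_partition p P) \<or> refines {1..n} (perm_partition p P) P"
      using \<tau> by (auto simp: order_complex_def Complete_Partial_Order.chain_def)
    moreover have "card (perm_partition p P) = card P"
      using p(1) by (intro card_perm_partition[of p "{1..n}"]) (simp add: sym_group_def)
    ultimately show ?thesis
      using refines_card_eq[of "{1..n}"] by (metis finite_atLeastAtMost)
  qed
  then show ?thesis using p(2) by auto
qed

lemma cell_dim_partition_complex_quotient:
  assumes "C \<in> partition_complex n"
  shows "cell_dim (partition_complex_quotient n)
           (orbit (sym_group n) (\<lambda>p. image (perm_partition p)) C) = card C - 1"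
proof -
  let ?O = "orbit (sym_group n) (\<lambda>p. image (perm_partition p)) C"
  have "finite C" "C \<noteq> {}" using assms by (auto simp: order_complex_def)
  then have pos: "card C = Suc (card C - 1)" by (simp add: card_gt_0_iff)
  have card: "card \<sigma> = card C" if "\<sigma> \<in> ?O" for \<sigma>
    using that unfolding orbit_def sym_group_def
    by (auto intro!: card_image intro: inj_on_subset[OF inj_perm_partition])
  have "id \<in> carrier (sym_group n)" by (simp add: sym_group_def permutes_id)
  then have ne: "perm_partition id ` C \<in> ?O" unfolding orbit_def by blast
  have "(THE d. \<forall>\<sigma>\<in>?O. card \<sigma> = Suc d) = card C - 1"
  proof (rule the_equality)
    show "\<forall>\<sigma>\<in>?O. card \<sigma> = Suc (card C - 1)" using card pos by metis
    show "d = card C - 1" if "\<forall>\<sigma>\<in>?O. card \<sigma> = Suc d" for d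
      using that ne card by (metis diff_Suc_1)
  qed
  then show ?thesis by (simp add: quotient_complex_def)
qed

lemma perm_partition_complex:
  assumes p: "p \<in> carrier (sym_group n)" and C: "C \<in> partition_complex n"
  shows "perm_partition p ` C \<in> partition_complex n"
proof -
  have perm: "p permutes {1..n}" using p by (simp add: sym_group_def)
  have im: "p ` {1..n} = {1..n}" using perm by (rule permutes_image)
  have part: "partition_on {1..n} (perm_partition p P)" if "partition_on {1..n} P" for P
  proof -
    have "partition_on (p ` {1..n}) ((`) p ` P - {{}})"
      by (rule partition_on_inj_image) (use that perm in \<open>auto simp: permutes_inj_on\<close>)
    moreover have "{} \<notin> (`) p ` P" using partition_onD3[OF that] by auto
    ultimately show ?thesis by (simp only: im perm_partition_def Diff_insert0 Diff_empty not_False_eq_True)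
  qed
  have inj: "inj (perm_partition p)" using perm by (rule inj_perm_partition)
  have sing: "perm_partition p ((\<lambda>i. {i}) ` {1..n}) = (\<lambda>i. {i}) ` {1..n}"
  proof -
    have "perm_partition p ((\<lambda>i. {i}) ` {1..n}) = (\<lambda>i. {i}) ` (p ` {1..n})"
      unfolding perm_partition_def by (simp add: image_image)
    then show ?thesis by (simp only: im)
  qed
  have one: "perm_partition p {{1..n}} = {{1..n}}" by (simp only: perm_partition_def image_insert image_empty im)
  have ref: "refines {1..n} (perm_partition p P) (perm_partition p Q)"
    if "refines {1..n} P Q" for P Q
  proof -
    have "partition_on {1..n} P" "partition_on {1..n} Q" "\<forall>X\<in>P. \<exists>Y\<in>Q. X \<subseteq> Y"
      using that by (auto simp: refines_def)
    moreover from this(3) have "\<forall>X\<in>perm_partition p P. \<exists>Y\<in>perm_partition p Q. X \<subseteq> Y"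
      unfolding perm_partition_def by (simp add: image_iff) (meson image_mono)
    ultimately show ?thesis unfolding refines_def using part by blast
  qed
  have "perm_partition p P \<in> proper_partitions n" if "P \<in> proper_partitions n" for P
    using that part inj sing one unfolding proper_partitions_def
    by (smt (verit) injD mem_Collect_eq)
  then show ?thesis
    using C ref unfolding order_complex_def Complete_Partial_Order.chain_def by auto blast+
qed

end

theory Submission
  imports Defs
begin

text \<open>
  Call a partition small if its blocks have at most two elements. Given a chain \<open>C\<close>, let \<open>R\<close> be
  the finest element of \<open>C \<union> {{[n]}}\<close> that is not small. The small elements of \<open>C\<close> form a chain of
  partial matchings inside the blocks of \<open>R\<close>, and this chain extends by a maximum matching \<open>Q\<close>
  inside these blocks, which is unique up to permutations fixing \<open>C\<close> elementwise. Pairing \<open>C\<close> with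
  \<open>C \<union> {Q}\<close> therefore matches the orbits of all chains, the empty one included; the partner of the
  empty chain is the vertex onto which the quotient collapses. The pairs are removed in order of
  decreasing number of non-small elements, then decreasing size, of \<open>C\<close>.
\<close>

section \<open>Collapsing along an acyclic matching\<close>

text \<open>The pairs are removed in order of decreasing \<open>r\<close>. When a pair has maximal
  \<open>r\<close> among those still present, its lower cell is free: by \<open>acyclic\<close>,
  every other cell above it belongs to a pair of larger \<open>r\<close>, which is already
  gone.\<close>

lemma collapsible_if_acyclic_matching:
  fixes K :: "'c cw_complex" and r :: "'c \<Rightarrow> nat"
  assumes fin: "finite (cells K)"
    and v: "v \<in> cells K" "cell_dim K v = 0" "v \<notin> Field M"
    and M: "cells K = insert v (Field M)"
    and face: "\<And>s t. (s, t) \<in> M \<Longrightarrow> face K s t \<and> cell_dim K t = Suc (cell_dim K s)"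
    and disj: "\<And>s t s' t'. (s, t) \<in> M \<Longrightarrow> (s', t') \<in> M \<Longrightarrow> {s, t} \<inter> {s', t'} \<noteq> {} \<Longrightarrow> s = s' \<and> t = t'"
    and acyclic: "\<And>s t u. (s, t) \<in> M \<Longrightarrow> u \<in> cells K \<Longrightarrow> face K s u \<Longrightarrow>
      u = s \<or> u = t \<or> (\<exists>s' t'. (s', t') \<in> M \<and> u \<in> {s', t'} \<and> r s < r s')"
  shows "collapsible K"
proof -
  have "finite (Field M)"
    using fin M by simp
  then have finM: "finite M"
    by (meson finite_SigmaI finite_subset FieldI1 FieldI2 mem_Sigma_iff subrelI)
  \<comment> \<open>Here \<open>N\<close> holds the pairs still present. As removal proceeds
    downwards in \<open>r\<close>, none of them outranks a removed pair.\<close>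
  have "\<exists>L. elementary_collapse\<^sup>*\<^sup>* (K\<lparr>cells := insert v (Field N)\<rparr>) L \<and> is_point L"
    if N: "N \<subseteq> M" "\<And>s t s' t'. (s, t) \<in> N \<Longrightarrow> (s', t') \<in> M - N \<Longrightarrow> r s \<le> r s'" for N
    using finite_subset[OF N(1) finM] N
  proof (induction N rule: finite_psubset_induct)
    case (psubset N)
    show ?case
    proof (cases "N = {}")
      case True
      then have "is_point (K\<lparr>cells := insert v (Field N)\<rparr>)"
        using v by (simp add: is_point_def)
      then show ?thesis by blast
    next
      case False
      let ?m = "Max ((r \<circ> fst) ` N)"
      have "?m \<in> (r \<circ> fst) ` N"
        using False psubset.hyps by (intro Max_in) auto
      then obtain s t where st: "(s, t) \<in> N" "r s = ?m" by auto
      have max: "r s' \<le> r s" if "(s', t') \<in> N" for s' t'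
        unfolding st(2) using that psubset.hyps by (intro Max_ge) (auto simp: rev_image_eqI)
      let ?N = "N - {(s, t)}"
      let ?K = "K\<lparr>cells := insert v (Field N)\<rparr>" and ?L = "K\<lparr>cells := insert v (Field ?N)\<rparr>"
      have stM: "(s, t) \<in> M" using st psubset.prems by blast
      have disjN: "s' = s \<and> t' = t" if "(s', t') \<in> M" "{s, t} \<inter> {s', t'} \<noteq> {}" for s' t'
        using disj[OF stM that] by simp
      have "v \<noteq> s" "v \<noteq> t"
        using v(3) stM by (auto simp: Field_def)
      then have cells: "insert v (Field ?N) = insert v (Field N) - {s, t}"
        using disjN psubset.prems(1) st(1) unfolding Field_def Domain_iff Range_iff
        by auto
      \<comment> \<open>Another remaining cell above \<open>s\<close> would lie in a pair of larger
        \<open>r\<close>. By disjointness this is the pair of \<open>N\<close> that contains it,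
        against the maximality of \<open>r s\<close>.\<close>
      have "u = s \<or> u = t" if u: "u \<in> insert v (Field N)" "face K s u" for u
      proof (rule ccontr)
        assume neq: "\<not> (u = s \<or> u = t)"
        have "u \<in> cells K"
          using u(1) psubset.prems(1) M by (auto simp: Field_def)
        then obtain s' t' where s't': "(s', t') \<in> M" "u \<in> {s', t'}" "r s < r s'"
          using acyclic[OF stM] u(2) neq by blast
        then have "u \<noteq> v"
          using v(3) by (auto simp: Field_def)
        then obtain a b where ab: "(a, b) \<in> N" "u \<in> {a, b}"
          using u(1) by (auto simp: Field_def)
        then have "(a, b) \<in> M" "{a, b} \<inter> {s', t'} \<noteq> {}"
          using s't' psubset.prems(1) by blast+
        then have "a = s'"
          using disj s't'(1) by blast
        then show False
          using max[OF ab(1)] s't'(3) by simp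
      qed
      then have free: "\<forall>u\<in>cells ?K. face ?K s u \<longrightarrow> u = s \<or> u = t" by simp
      have "s \<in> cells ?K" "t \<in> cells ?K"
        using st(1) by (auto simp: Field_def)
      moreover have "face ?K s t" "cell_dim ?K t = Suc (cell_dim ?K s)"
        using face[OF stM] by simp_all
      moreover have "?L = ?K\<lparr>cells := cells ?K - {s, t}\<rparr>"
        unfolding cells by simp
      ultimately have "elementary_collapse ?K ?L"
        unfolding elementary_collapse_def using free by blast
      moreover have "\<exists>L. elementary_collapse\<^sup>*\<^sup>* ?L L \<and> is_point L"
      proof (rule psubset.IH)
        show "r a \<le> r a'" if "(a, b) \<in> ?N" "(a', b') \<in> M - ?N" for a b a' b'
          using that max psubset.prems(2) by (cases "(a', b') = (s, t)") auto
      qed (use st psubset.prems(1) in auto)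
      ultimately show ?thesis
        by (meson converse_rtranclp_into_rtranclp)
    qed
  qed
  from this[of M] have "\<exists>L. elementary_collapse\<^sup>*\<^sup>* K L \<and> is_point L"
    using M by (metis DiffE cw_complex.surjective cw_complex.update_convs(1) order_refl)
  then show ?thesis
    using fin by (simp add: collapsible_def)
qed

section \<open>Partitions into blocks of size at most two\<close>

definition small :: "'a set set \<Rightarrow> bool" where
  "small P \<longleftrightarrow> (\<forall>B\<in>P. card B \<le> 2)"

text \<open>For small \<open>Q\<close> refining \<open>P\<close>, this says that \<open>Q\<close> is a maximum matching inside each block of \<open>P\<close>.\<close>
definition full :: "'a set set \<Rightarrow> 'a set set \<Rightarrow> bool" where
  "full Q P \<longleftrightarrow> (\<forall>B\<in>P. \<forall>x\<in>B. \<forall>y\<in>B. {x} \<in> Q \<longrightarrow> {y} \<in> Q \<longrightarrow> x = y)"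

lemma partition_on_block_unique:
  assumes "partition_on A P" "B \<in> P" "C \<in> P" "x \<in> B" "x \<in> C"
  shows "B = C"
  using assms by (meson disjoint_iff partition_onD2 disjointD)

lemma partition_on_obtain_block:
  assumes "partition_on A P" "x \<in> A"
  obtains B where "B \<in> P" "x \<in> B" "B \<subseteq> A"
  using assms partition_onD1 by fastforce

lemma refines_block_subset:
  assumes "refines A P Q" "X \<in> P" "Y \<in> Q" "x \<in> X" "x \<in> Y"
  shows "X \<subseteq> Y"
proof -
  obtain Y' where Y': "Y' \<in> Q" "X \<subseteq> Y'"
    using assms(1,2) by (auto simp: refines_def)
  moreover have "partition_on A Q"
    using assms(1) by (simp add: refines_def)
  ultimately have "Y' = Y"
    using partition_on_block_unique assms(3-5) by (metis subsetD)
  then show ?thesis using Y'(2) by simp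
qed

lemma small_block_cases:
  assumes "finite A" "partition_on A Q" "small Q" "x \<in> A"
  obtains "{x} \<in> Q" | y where "y \<noteq> x" "{x, y} \<in> Q"
proof -
  obtain B where B: "B \<in> Q" "x \<in> B" "B \<subseteq> A"
    using partition_on_obtain_block assms by metis
  have "finite B" "card B \<le> 2"
    using B assms by (auto simp: small_def intro: finite_subset)
  then have "card (B - {x}) \<le> Suc 0" "finite (B - {x})"
    using B by auto
  then consider "B - {x} = {}" | y where "B - {x} = {y}"
    by (metis card_le_Suc0_iff_eq ex_in_conv insert_iff is_singletonE is_singletonI')
  then show thesis
  proof cases
    case 1
    then have "B = {x}" using B by blast
    then show ?thesis using that B by blast
  next
    case (2 y)
    then have "B = {x, y}" "y \<noteq> x" using B by blast+
    then show ?thesis using that B by blast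
  qed
qed

lemma refines_small:
  assumes "finite A" "refines A P Q" "small Q"
  shows "small P"
  unfolding small_def
proof
  fix X assume "X \<in> P"
  then obtain Y where Y: "Y \<in> Q" "X \<subseteq> Y"
    using assms(2) by (auto simp: refines_def)
  moreover have "finite Y"
    using Y(1) assms(1,2) by (auto simp: refines_def partition_on_def intro: finite_subset)
  ultimately show "card X \<le> 2"
    using assms(3) card_mono[of Y X] by (fastforce simp: small_def)
qed

lemma full_refines: "refines A P P' \<Longrightarrow> full Q P' \<Longrightarrow> full Q P"
  unfolding full_def refines_def by (meson subsetD)

text \<open>If a block {x, y} of \<open>Q'\<close> is not a block of \<open>Q\<close>, then {x} and
  {y} are both blocks of \<open>Q\<close>. They lie in a common block of \<open>P\<close>, which
  fullness forbids. Hence \<open>Q'\<close> refines \<open>Q\<close> as well.\<close>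

lemma full_maximal:
  assumes A: "finite A" and full: "full Q P" and ref: "refines A Q Q'" "refines A Q' P" and small: "small Q'"
  shows "Q' = Q"
proof -
  have part: "partition_on A Q" "partition_on A Q'" "partition_on A P"
    using ref by (auto simp: refines_def)
  have "\<exists>X\<in>Q. Y \<subseteq> X" if Y: "Y \<in> Q'" for Y
  proof -
    obtain x where x: "x \<in> Y" "x \<in> A"
      using Y part(2) by (metis Union_iff ex_in_conv partition_onD1 partition_onD3)
    from A part(2) small x(2) show ?thesis
    proof (cases rule: small_block_cases)
      case 1
      then have "Y = {x}"
        using Y x part(2) by (metis partition_on_block_unique singletonI)
      moreover obtain X where "X \<in> Q" "x \<in> X"
        using partition_on_obtain_block part(1) x by metis
      ultimately show ?thesis by blast
    next
      case (2 y)
      then have Yxy: "Y = {x, y}"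
        using Y x part(2) by (metis partition_on_block_unique insertI1)
      then have "y \<in> A" using Y part(2) partition_onD1 by blast
      obtain B where B: "B \<in> P" "x \<in> B" "y \<in> B"
        using ref(2) Y Yxy by (auto simp: refines_def)
      obtain X where X: "X \<in> Q" "x \<in> X"
        using partition_on_obtain_block part(1) x by metis
      obtain Z where Z: "Z \<in> Q" "y \<in> Z"
        using partition_on_obtain_block part(1) \<open>y \<in> A\<close> by metis
      have sub: "X \<subseteq> Y" "Z \<subseteq> Y"
        using refines_block_subset[OF ref(1)] X Z Y x Yxy by blast+
      show ?thesis
      proof (cases "y \<in> X")
        case True
        then show ?thesis using X Yxy by blast
      next
        case False
        then have "X = {x}" using sub X Yxy by blast
        moreover from this have "Z = {y}"
          using sub Z X Yxy False part(1) by (metis partition_on_block_unique insert_iff subset_insert subset_singletonD singletonD empty_iff)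
        ultimately show ?thesis
          using full B X Z 2(1) unfolding full_def by blast
      qed
    qed
  qed
  then have "refines A Q' Q"
    using part by (simp add: refines_def)
  then show ?thesis
    using ref(1) refines_asym by blast
qed

text \<open>Among the small partitions between \<open>S\<close> and \<open>P\<close>, take one with
  the fewest blocks. Merging two of its singletons inside a block of \<open>P\<close> would give one
  with fewer.\<close>

lemma ex_full_between:
  assumes A: "finite A" and ref: "refines A S P" and small: "small S"
  shows "\<exists>Q. refines A S Q \<and> refines A Q P \<and> small Q \<and> full Q P"
proof -
  define \<Q> where "\<Q> = {Q. refines A S Q \<and> refines A Q P \<and> small Q}"
  have "S \<in> \<Q>"
    using ref small by (auto simp: \<Q>_def refines_def)
  then obtain Q where Q: "Q \<in> \<Q>" and min: "\<And>Q'. Q' \<in> \<Q> \<Longrightarrow> card Q \<le> card Q'"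
    using ex_has_least_nat[of "\<lambda>Q. Q \<in> \<Q>" S card] by blast
  have part: "partition_on A Q"
    using Q by (auto simp: \<Q>_def refines_def)
  have "x = y" if "B \<in> P" "x \<in> B" "y \<in> B" "{x} \<in> Q" "{y} \<in> Q" for B x y
  proof (rule ccontr)
    assume neq: "x \<noteq> y"
    define Q' where "Q' = insert {x, y} (Q - {{x}, {y}})"
    have uniq: "Z = {z}" if "Z \<in> Q" "z \<in> Z" "z \<in> {x, y}" for z Z
      using partition_on_block_unique[OF part] that \<open>{x} \<in> Q\<close> \<open>{y} \<in> Q\<close> by (metis insertE singletonD singletonI)
    have part': "partition_on A Q'"
    proof (rule partition_onI)
      show "\<Union>Q' = A"
        using partition_onD1[OF part] \<open>{x} \<in> Q\<close> \<open>{y} \<in> Q\<close> by (auto simp: Q'_def)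
      show "{} \<notin> Q'"
        using partition_onD3[OF part] by (auto simp: Q'_def)
      fix X Y assume "X \<in> Q'" "Y \<in> Q'" "X \<noteq> Y"
      then show "disjnt X Y"
        using uniq partition_onD2[OF part] unfolding Q'_def disjnt_iff
        by (smt (verit) Diff_iff insert_iff partition_on_block_unique[OF part] empty_iff)
    qed
    have "refines A Q Q'"
      unfolding refines_def using part part' by (auto simp: Q'_def)
    moreover have "refines A Q' P"
      using Q part' that by (auto simp: Q'_def \<Q>_def refines_def)
    moreover have "small Q'"
      using Q neq by (auto simp: Q'_def \<Q>_def small_def)
    ultimately have "Q' \<in> \<Q>"
      using Q refines_trans by (auto simp: \<Q>_def)
    then have "card Q \<le> card Q'" by (rule min)
    moreover have "finite Q" using finite_elements[OF A part] .
    then have "card Q' \<le> Suc (card (Q - {{x}, {y}}))" "card (Q - {{x}, {y}}) = card Q - 2" "2 \<le> card Q"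
      using \<open>{x} \<in> Q\<close> \<open>{y} \<in> Q\<close> neq card_mono[of Q "{{x}, {y}}"]
      by (auto simp: Q'_def card_insert_if card_Diff_subset)
    ultimately show False by linarith
  qed
  then show ?thesis
    using Q unfolding full_def \<Q>_def by blast
qed

section \<open>Permutations and uniqueness of maximum matchings\<close>

lemma perm_partition_compose: "perm_partition (p \<circ> q) P = perm_partition p (perm_partition q P)"
  by (simp add: perm_partition_def image_comp comp_def)

lemma perm_partition_id [simp]: "perm_partition id P = P"
  by (simp add: perm_partition_def)

lemma perm_partition_inverse:
  assumes "p permutes A"
  shows "perm_partition (inv_into UNIV p) (perm_partition p P) = P"
  by (simp only: perm_partition_compose[symmetric] permutes_inv_o[OF assms] perm_partition_id)

lemma small_perm_partition:
  assumes "p permutes A"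
  shows "small (perm_partition p P) \<longleftrightarrow> small P"
proof -
  have "card (p ` B) = card B" for B
    using assms by (meson card_image inj_on_subset permutes_inj subset_UNIV)
  then show ?thesis by (simp add: small_def perm_partition_def)
qed

lemma full_perm_partition:
  assumes "p permutes A" "full Q P"
  shows "full (perm_partition p Q) (perm_partition p P)"
proof -
  have "{p x} \<in> (`) p ` Q \<longleftrightarrow> {x} \<in> Q" for x
    using inj_image_mem_iff[OF inj_image_perm[OF assms(1)], of "{x}" Q] by simp
  then show ?thesis
    using assms(2) unfolding full_def perm_partition_def by (auto simp del: image_iff) metis
qed

lemma refines_perm_partition:
  assumes p: "p permutes A" and ref: "refines A P Q"
  shows "refines A (perm_partition p P) (perm_partition p Q)"
proof -
  have part: "partition_on A (perm_partition p P)" if "partition_on A P" for P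
  proof -
    have "partition_on (p ` A) ((`) p ` P - {{}})"
      by (rule partition_on_inj_image) (use that p in \<open>auto simp: permutes_inj_on\<close>)
    moreover have "{} \<notin> (`) p ` P" using partition_onD3[OF that] by auto
    ultimately show ?thesis
      by (simp add: permutes_image[OF p] perm_partition_def)
  qed
  have "\<exists>Y\<in>perm_partition p Q. X \<subseteq> Y" if X: "X \<in> perm_partition p P" for X
  proof -
    obtain X' Y' where "X = p ` X'" "Y' \<in> Q" "X' \<subseteq> Y'"
      using X ref by (auto simp: refines_def perm_partition_def)
    then show ?thesis
      unfolding perm_partition_def by (meson image_eqI image_mono)
  qed
  then show ?thesis
    using ref part by (simp add: refines_def)
qed

lemma perm_partition_transpose_same_block:
  assumes T: "partition_on A T" and B: "B \<in> T" "y \<in> B" "z \<in> B"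
  shows "perm_partition (transpose y z) T = T"
proof -
  have "transpose y z ` X = X" if "X \<in> T" for X
  proof (cases "X = B")
    case True
    then show ?thesis using B by simp
  next
    case False
    then have "y \<notin> X" "z \<notin> X"
      using partition_on_block_unique[OF T that B(1)] B by auto
    then show ?thesis by simp
  qed
  then show ?thesis by (simp add: perm_partition_def)
qed

lemma perm_partition_transpose_singletons:
  assumes T: "partition_on A T" and yz: "{y} \<in> T" "{z} \<in> T"
  shows "perm_partition (transpose y z) T = T"
proof -
  have "transpose y z ` X \<in> T" if "X \<in> T" for X
  proof (cases "y \<in> X \<or> z \<in> X")
    case True
    then have "X = {y} \<or> X = {z}"
      using partition_on_block_unique[OF T that yz(1)] partition_on_block_unique[OF T that yz(2)] by auto
    then show ?thesis using yz by auto
  next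
    case False
    then show ?thesis using that by simp
  qed
  then have sub: "perm_partition (transpose y z) T \<subseteq> T"
    by (auto simp: perm_partition_def)
  \<comment> \<open>The transposition is an involution, so applying it to the inclusion just proved
    yields the reverse inclusion.\<close>
  then have "perm_partition (transpose y z) (perm_partition (transpose y z) T) \<subseteq> perm_partition (transpose y z) T"
    unfolding perm_partition_def by (rule image_mono)
  moreover have "perm_partition (transpose y z) (perm_partition (transpose y z) T) = T"
    by (simp only: perm_partition_compose[symmetric] transpose_comp_involutory perm_partition_id)
  ultimately show ?thesis
    using sub by simp
qed

text \<open>Induction on the number of blocks of \<open>Q'\<close> missing from \<open>Q\<close>. If
  {x, y} is in \<open>Q\<close> and {x, z} is in \<open>Q'\<close>, the transposition of y and z
  turns the first block into the second and keeps all blocks common to \<open>Q\<close> and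
  \<open>Q'\<close>. It fixes every \<open>T\<close> in \<open>C\<close>: above \<open>R\<close>,
  both points lie in one block of \<open>T\<close>; below \<open>Q\<close> and \<open>Q'\<close>,
  both are singletons of \<open>T\<close>.\<close>

lemma full_unique_up_to_perm:
  fixes A :: "nat set"
  assumes A: "finite A"
    and Q: "refines A Q R" "small Q" "full Q R"
    and Q': "refines A Q' R" "small Q'" "full Q' R"
    and C: "\<And>T. T \<in> C \<Longrightarrow> refines A T Q \<and> refines A T Q' \<or> refines A R T"
  shows "\<exists>p. p permutes A \<and> (\<forall>T\<in>C. perm_partition p T = T) \<and> perm_partition p Q = Q'"
  using Q C
proof (induction "card (Q' - Q)" arbitrary: Q rule: less_induct)
  case less
  have part: "partition_on A Q" "partition_on A Q'" "partition_on A R"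
    using less.prems Q' by (auto simp: refines_def)
  show ?case
  proof (cases "refines A Q Q'")
    case True
    then have "Q' = Q"
      using full_maximal[OF A less.prems(3)] Q' by blast
    then show ?thesis
      by (intro exI[of _ id]) (simp add: permutes_id)
  next
    case False
    then obtain X where X: "X \<in> Q" "\<And>Y. Y \<in> Q' \<Longrightarrow> \<not> X \<subseteq> Y"
      using part by (auto simp: refines_def)
    obtain x y where xy: "x \<noteq> y" "X = {x, y}"
    proof -
      obtain x where x: "x \<in> X" "x \<in> A"
        using X part(1) by (metis Union_iff ex_in_conv partition_onD1 partition_onD3)
      from A part(1) less.prems(2) x(2) show thesis
      proof (cases rule: small_block_cases)
        case 1
        then have "X = {x}"
          using X x part(1) by (metis partition_on_block_unique singletonI)
        then show thesis
          using X(2) partition_on_obtain_block[OF part(2) x(2)] by (metis empty_subsetI insert_subset)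
      next
        case (2 y)
        then have "X = {x, y}"
          using X x part(1) by (metis partition_on_block_unique insertI1)
        then show thesis using that 2 by metis
      qed
    qed
    obtain B where B: "B \<in> R" "x \<in> B" "y \<in> B"
      using less.prems(1) X xy by (auto simp: refines_def)
    have xyA: "x \<in> A" "y \<in> A"
      using X xy part(1) partition_onD1 by blast+
    \<comment> \<open>Fullness of \<open>Q'\<close> leaves at most one of x and y unmatched in
      \<open>Q'\<close>. After renaming, x has a partner z there, and z differs from y because
      \<open>X\<close> lies in no block of \<open>Q'\<close>.\<close>
    have "\<not> ({x} \<in> Q' \<and> {y} \<in> Q')"
      using Q'(3) B xy by (auto simp: full_def)
    then obtain x y z where xyz: "x \<noteq> y" "z \<noteq> x" "X = {x, y}" "{x, z} \<in> Q'"
    proof (cases "{x} \<in> Q'")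
      case False
      from A part(2) Q'(2) xyA(1) obtain z where "z \<noteq> x" "{x, z} \<in> Q'"
        by (rule small_block_cases) (use False in auto)
      then show thesis using that[of x y z] xy by blast
    next
      case True
      then have False: "{y} \<notin> Q'" using \<open>\<not> ({x} \<in> Q' \<and> {y} \<in> Q')\<close> by blast
      from A part(2) Q'(2) xyA(2) obtain z where "z \<noteq> y" "{y, z} \<in> Q'"
        by (rule small_block_cases) (use False in auto)
      then show thesis using that[of y x z] xy by blast
    qed
    then have "z \<noteq> y" using X by auto
    obtain B where B: "B \<in> R" "x \<in> B" "y \<in> B"
      using less.prems(1) X xyz by (auto simp: refines_def)
    have zB: "z \<in> B"
      using refines_block_subset[OF Q'(1) xyz(4) B(1)] B by blast
    have yzA: "y \<in> A" "z \<in> A"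
      using B zB part(3) partition_onD1 by blast+
    let ?p = "transpose y z"
    have p: "?p permutes A"
      using yzA by (simp add: permutes_swap_id)
    have notQ: "{x, z} \<notin> Q"
      using partition_on_block_unique[OF part(1), of "{x, z}" X x] X xyz \<open>z \<noteq> y\<close> by auto
    have fixR: "perm_partition ?p T = T" if RT: "refines A R T" for T
    proof -
      obtain B' where "B' \<in> T" "B \<subseteq> B'"
        using RT B by (auto simp: refines_def)
      moreover have "partition_on A T"
        using that by (simp add: refines_def)
      ultimately show ?thesis
        using perm_partition_transpose_same_block B(3) zB by blast
    qed
    \<comment> \<open>The block of y in \<open>T\<close> lies inside {x, y}. It avoids x, since
      otherwise it would lie inside {x, z}, which does not contain y. The same argument with the two
      matchings exchanged makes {z} a block of \<open>T\<close>.\<close>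
    have fixS: "perm_partition ?p T = T" if T: "refines A T Q" "refines A T Q'" for T
    proof -
      have partT: "partition_on A T" using T by (simp add: refines_def)
      obtain Y where Y: "Y \<in> T" "y \<in> Y" using partition_on_obtain_block[OF partT yzA(1)] by metis
      obtain Z where Z: "Z \<in> T" "z \<in> Z" using partition_on_obtain_block[OF partT yzA(2)] by metis
      have "Y \<subseteq> {x, y}" "Z \<subseteq> {x, z}"
        using refines_block_subset[OF T(1) Y(1)] refines_block_subset[OF T(2) Z(1)] X xyz Y Z by auto
      moreover have "x \<notin> Y"
        using refines_block_subset[OF T(2) Y(1) xyz(4)] Y(2) xyz \<open>z \<noteq> y\<close> by auto
      moreover have "x \<notin> Z"
        using refines_block_subset[OF T(1) Z(1) X(1)] Z(2) xyz \<open>z \<noteq> y\<close> by auto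
      ultimately have "Y = {y}" "Z = {z}" using Y Z by blast+
      then show ?thesis
        using perm_partition_transpose_singletons partT Y Z by blast
    qed
    have fixC: "perm_partition ?p T = T" if "T \<in> C" for T
      using less.prems(4)[OF that] fixR fixS by blast
    have R: "perm_partition ?p R = R"
      using fixR refines_refl part(3) by blast
    let ?Q = "perm_partition ?p Q"
    \<comment> \<open>A block common to \<open>Q\<close> and \<open>Q'\<close> contains neither y
      nor z, so it survives the transposition, and {x, z} is gained.\<close>
    have "Q' - ?Q \<subset> Q' - Q"
    proof
      show "Q' - ?Q \<subseteq> Q' - Q"
      proof
        fix Z assume Z: "Z \<in> Q' - ?Q"
        have "Z \<notin> Q"
        proof
          assume ZQ: "Z \<in> Q"
          have "y \<notin> Z"
            using partition_on_block_unique[OF part(1) ZQ X(1), of y] xyz X(2) Z by auto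
          moreover have "z \<notin> Z"
            using partition_on_block_unique[OF part(2) _ xyz(4), of Z z] Z ZQ notQ by auto
          ultimately have "?p ` Z = Z" by simp
          then show False using Z ZQ unfolding perm_partition_def by (metis DiffD2 imageI)
        qed
        then show "Z \<in> Q' - Q" using Z by blast
      qed
      have "?p ` X = {x, z}" using xyz by (simp add: transpose_def)
      then have "{x, z} \<in> ?Q" using X(1) unfolding perm_partition_def by (metis imageI)
      then show "Q' - ?Q \<noteq> Q' - Q" using notQ xyz(4) by blast
    qed
    then have "card (Q' - ?Q) < card (Q' - Q)"
      using finite_elements[OF A part(2)] by (intro psubset_card_mono) auto
    moreover have "refines A ?Q R"
      using refines_perm_partition[OF p less.prems(1)] R by simp
    moreover have "small ?Q"
      using less.prems(2) small_perm_partition[OF p] by simp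
    moreover have "full ?Q R"
      using full_perm_partition[OF p less.prems(3)] R by simp
    moreover have "refines A T ?Q \<and> refines A T Q' \<or> refines A R T" if "T \<in> C" for T
      using less.prems(4)[OF that] refines_perm_partition[OF p, of T Q] fixC[OF that] by auto
    ultimately obtain q where q: "q permutes A" "\<forall>T\<in>C. perm_partition q T = T" "perm_partition q ?Q = Q'"
      using less.hyps by metis
    then show ?thesis
      using fixC p by (intro exI[of _ "q \<circ> ?p"]) (simp add: permutes_compose perm_partition_compose)
  qed
qed

section \<open>The matching on orbits of chains\<close>

abbreviation orb :: "nat \<Rightarrow> nat set set set \<Rightarrow> nat set set set set" where
  "orb n \<equiv> orbit (sym_group n) (\<lambda>p. image (perm_partition p))"

lemma orb_iff: "C' \<in> orb n C \<longleftrightarrow> (\<exists>p. p permutes {1..n} \<and> C' = perm_partition p ` C)"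
  by (auto simp: orbit_def sym_group_carrier)

lemma orb_refl: "C \<in> orb n C"
  unfolding orb_iff by (intro exI[of _ id]) (simp add: permutes_id)

lemma orb_perm:
  assumes p: "p permutes {1..n}"
  shows "orb n (perm_partition p ` C) = orb n C"
proof -
  have sub: "orb n (perm_partition q ` C) \<subseteq> orb n C" if q: "q permutes {1..n}" for q C
  proof
    fix E assume "E \<in> orb n (perm_partition q ` C)"
    then obtain r where "r permutes {1..n}" "E = perm_partition r ` perm_partition q ` C"
      by (auto simp: orb_iff)
    then show "E \<in> orb n C"
      unfolding orb_iff using q
      by (intro exI[of _ "r \<circ> q"]) (simp add: permutes_compose perm_partition_compose image_image)
  qed
  have "perm_partition (inv_into UNIV p) ` perm_partition p ` C = C"
    by (simp add: image_image perm_partition_inverse[OF p])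
  then have "orb n C \<subseteq> orb n (perm_partition p ` C)"
    using sub[OF permutes_inv[OF p], of "perm_partition p ` C"] by simp
  then show ?thesis using sub[OF p] by blast
qed

lemma orb_eq_iff: "orb n C = orb n C' \<longleftrightarrow> (\<exists>p. p permutes {1..n} \<and> C' = perm_partition p ` C)"
  by (metis orb_iff orb_perm orb_refl)

lemma orb_eqE:
  assumes "orb n C = orb n C'"
  obtains p where "p permutes {1..n}" "C' = perm_partition p ` C"
  using assms unfolding orb_eq_iff by blast

text \<open>
  Quantifying over all non-small \<open>P\<close> gives the same as taking the finest one, since \<open>full Q\<close> is
  inherited by refinements (\<open>full_refines\<close>). The set \<open>{{1..n}}\<close> serves as \<open>P\<close> if \<open>C\<close> consists of
  small partitions only.
\<close>
definition completes :: "nat \<Rightarrow> nat set set \<Rightarrow> nat set set set \<Rightarrow> bool" where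
  "completes n Q C \<longleftrightarrow> small Q \<and> (\<exists>P\<in>insert {{1..n}} C. \<not> small P \<and> full Q P)"

lemma completes_insert: "completes n Q C \<Longrightarrow> completes n Q (insert P C)"
  by (auto simp: completes_def)

text \<open>Either side forces \<open>Q\<close> to be small, so inserting it adds no candidate for
  the non-small partition.\<close>

lemma completes_insert_self: "completes n Q (insert Q C) \<longleftrightarrow> completes n Q C"
  by (auto simp: completes_def)

lemma completes_perm:
  assumes p: "p permutes {1..n}" and "completes n Q C"
  shows "completes n (perm_partition p Q) (perm_partition p ` C)"
proof -
  have "perm_partition p {{1..n}} = {{1..n}}"
    using permutes_image[OF p] by (simp add: perm_partition_def)
  then show ?thesis
    using assms small_perm_partition[OF p] full_perm_partition[OF p]
    unfolding completes_def by (metis image_eqI image_insert)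
qed

section \<open>Chains of partitions with the one-block partition adjoined\<close>

lemma partition_complexD:
  assumes "C \<in> insert {} (partition_complex n)"
  shows "finite C" "C \<subseteq> proper_partitions n"
    "\<And>P Q. P \<in> C \<Longrightarrow> Q \<in> C \<Longrightarrow> refines {1..n} P Q \<or> refines {1..n} Q P"
  using assms by (auto simp: order_complex_def Complete_Partial_Order.chain_def)

lemma partition_complex_subset:
  assumes "C \<in> partition_complex n" "E \<subseteq> C" "E \<noteq> {}"
  shows "E \<in> partition_complex n"
  using assms unfolding order_complex_def Complete_Partial_Order.chain_def mem_Collect_eq
  by (meson finite_subset subset_iff)

lemma partition_on_proper_partitions: "P \<in> proper_partitions n \<Longrightarrow> partition_on {1..n} P"
  by (simp add: proper_partitions_def)

lemma refines_top:
  fixes n :: nat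
  assumes "partition_on {1..n} P" "n \<ge> 3"
  shows "refines {1..n} P {{1..n}}"
proof -
  have "partition_on {1..n} {{1..n}}"
    using assms(2) by (intro partition_on_space) simp
  moreover have "X \<subseteq> {1..n}" if "X \<in> P" for X
    using that partition_onD1[OF assms(1)] by blast
  ultimately show ?thesis
    using assms(1) by (simp add: refines_def)
qed

lemma not_small_top: "(n::nat) \<ge> 3 \<Longrightarrow> \<not> small {{1..n}}"
  by (simp add: small_def)

lemma chain_with_top:
  assumes n: "n \<ge> 3" and C: "C \<in> insert {} (partition_complex n)"
    and P: "P \<in> insert {{1..n}} C" and Q: "Q \<in> insert {{1..n}} C"
  shows "refines {1..n} P Q \<or> refines {1..n} Q P"
proof -
  have "refines {1..n} T {{1..n}}" if "T \<in> insert {{1..n}} C" for T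
  proof -
    have "partition_on {1..n} T"
      using that partition_complexD(2)[OF C] n partition_on_space[of "{1..n}"]
      by (auto simp: proper_partitions_def)
    then show ?thesis using n refines_top by blast
  qed
  then show ?thesis
    using P Q partition_complexD(3)[OF C] by blast
qed

text \<open>The two are comparable, and anything refining a small partition is small.\<close>

lemma small_refines_not_small:
  assumes n: "n \<ge> 3" and C: "C \<in> insert {} (partition_complex n)"
    and P: "P \<in> insert {{1..n}} C" "small P" and Q: "Q \<in> insert {{1..n}} C" "\<not> small Q"
  shows "refines {1..n} P Q"
  using chain_with_top[OF n C P(1) Q(1)] refines_small P(2) Q(2) by blast

lemma finite_chain_least:
  assumes "finite X" "X \<noteq> {}" "\<And>P Q. P \<in> X \<Longrightarrow> Q \<in> X \<Longrightarrow> refines A P Q \<or> refines A Q P"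
  shows "\<exists>R\<in>X. \<forall>P\<in>X. refines A R P"
  using assms
proof (induction X rule: finite_ne_induct)
  case (insert P X)
  then obtain R where R: "R \<in> X" "\<forall>P\<in>X. refines A R P" by blast
  have "refines A P P" "refines A P R \<or> refines A R P"
    using insert.prems R(1) by blast+
  then show ?case
    using R refines_trans by (metis insert_iff)
qed blast

lemma finite_chain_greatest:
  assumes "finite X" "X \<noteq> {}" "\<And>P Q. P \<in> X \<Longrightarrow> Q \<in> X \<Longrightarrow> refines A P Q \<or> refines A Q P"
  shows "\<exists>S\<in>X. \<forall>P\<in>X. refines A P S"
  using assms
proof (induction X rule: finite_ne_induct)
  case (insert P X)
  then obtain R where R: "R \<in> X" "\<forall>P\<in>X. refines A P R" by blast
  have "refines A P P" "refines A P R \<or> refines A R P"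
    using insert.prems R(1) by blast+
  then show ?case
    using R refines_trans by (metis insert_iff)
qed blast

lemma least_not_small:
  assumes n: "n \<ge> 3" and C: "C \<in> insert {} (partition_complex n)"
  obtains R where "R \<in> insert {{1..n}} C" "\<not> small R"
    "\<And>P. P \<in> insert {{1..n}} C \<Longrightarrow> \<not> small P \<Longrightarrow> refines {1..n} R P"
proof -
  have "\<exists>R\<in>{P \<in> insert {{1..n}} C. \<not> small P}. \<forall>P\<in>{P \<in> insert {{1..n}} C. \<not> small P}. refines {1..n} R P"
    using partition_complexD(1)[OF C] not_small_top[OF n] chain_with_top[OF n C]
    by (intro finite_chain_least) auto
  then show thesis using that by blast
qed

section \<open>Existence and uniqueness of the completing partition\<close>

text \<open>With \<open>S\<close> the coarsest small element and \<open>R\<close> the finest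
  non-small one, \<open>Q\<close> is a maximum matching between them. It is comparable with the
  whole chain because small elements refine \<open>S\<close> and non-small ones are refined by
  \<open>R\<close>.\<close>

lemma ex_completes:
  assumes n: "n \<ge> 3" and C: "C \<in> insert {} (partition_complex n)"
    and not: "\<And>Q. Q \<in> C \<Longrightarrow> \<not> completes n Q C"
  obtains Q where "Q \<notin> C" "completes n Q C" "insert Q C \<in> partition_complex n"
proof -
  obtain R where R: "R \<in> insert {{1..n}} C" "\<not> small R"
    "\<And>P. P \<in> insert {{1..n}} C \<Longrightarrow> \<not> small P \<Longrightarrow> refines {1..n} R P"
    using least_not_small[OF n C] by metis
  have partR: "partition_on {1..n} R"
    using R(3)[OF R(1,2)] by (simp add: refines_def)
  let ?singles = "(\<lambda>i. {i}) ` {1..n}"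
  have part0: "partition_on {1..n} ?singles" by (rule partition_on_singletons)
  have bot: "refines {1..n} ?singles P" if "partition_on {1..n} P" for P
    using that part0 partition_onD1[OF that] by (auto simp: refines_def)
  \<comment> \<open>The singleton partition serves as \<open>S\<close> if the chain has no small
    element.\<close>
  let ?X = "insert ?singles {P \<in> C. small P}"
  have "\<exists>S\<in>?X. \<forall>P\<in>?X. refines {1..n} P S"
  proof (rule finite_chain_greatest)
    show "refines {1..n} P Q \<or> refines {1..n} Q P" if "P \<in> ?X" "Q \<in> ?X" for P Q
      using that bot part0 partition_complexD(2,3)[OF C] partition_on_proper_partitions by blast
  qed (use partition_complexD(1)[OF C] in auto)
  then obtain S where S: "S \<in> ?X" "\<And>P. P \<in> ?X \<Longrightarrow> refines {1..n} P S" by blast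
  have "small S"
    using S(1) by (auto simp: small_def)
  moreover have "refines {1..n} S R"
    using S(1) bot[OF partR] small_refines_not_small[OF n C _ _ R(1,2)] by blast
  ultimately obtain Q where Q: "refines {1..n} S Q" "refines {1..n} Q R" "small Q" "full Q R"
    using ex_full_between[of "{1..n}" S R] by blast
  have partQ: "partition_on {1..n} Q" using Q(1) by (simp add: refines_def)
  have compl: "completes n Q C"
    using Q R(1,2) by (auto simp: completes_def)
  \<comment> \<open>Being non-small, \<open>R\<close> has a block with more than two points. Were
    all of them singletons of \<open>Q\<close>, fullness would fail.\<close>
  have "Q \<noteq> ?singles"
  proof
    assume Q0: "Q = ?singles"
    obtain B where B: "B \<in> R" "\<not> card B \<le> 2"
      using R(2) by (auto simp: small_def)
    then have "B \<subseteq> {1..n}" "finite B"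
      using partition_onD1[OF partR] by (auto intro: card_ge_0_finite)
    moreover have "\<not> card B \<le> Suc 0" using B(2) by simp
    ultimately obtain x y where "x \<in> B" "y \<in> B" "x \<noteq> y"
      by (metis card_le_Suc0_iff_eq)
    then show False
      using Q(4) B(1) \<open>B \<subseteq> {1..n}\<close> unfolding Q0 full_def by blast
  qed
  moreover have "Q \<noteq> {{1..n}}"
    using Q(3) not_small_top[OF n] by blast
  ultimately have proper: "Q \<in> proper_partitions n"
    using partQ by (simp add: proper_partitions_def)
  have comp: "refines {1..n} T Q \<or> refines {1..n} Q T" if "T \<in> insert Q C" for T
  proof (cases "T = Q")
    case True
    then show ?thesis using refines_refl partQ by blast
  next
    case False
    then have "T \<in> C" using that by blast
    show ?thesis
    proof (cases "small T")
      case True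
      then have "refines {1..n} T S" using S(2) \<open>T \<in> C\<close> by simp
      from refines_trans[OF this Q(1)] show ?thesis by simp
    next
      case False
      then have "refines {1..n} R T" using R(3) \<open>T \<in> C\<close> by simp
      from refines_trans[OF Q(2) this] show ?thesis by simp
    qed
  qed
  then have "insert Q C \<in> partition_complex n"
    using proper partition_complexD[OF C]
    by (auto simp: order_complex_def Complete_Partial_Order.chain_def)
  then show thesis
    using that compl not by blast
qed

text \<open>Two completing elements of one chain are small and comparable. The finer is full in some
  non-small \<open>P\<close>, which the coarser refines, so \<open>full_maximal\<close> identifies
  them.\<close>

lemma completes_unique:
  assumes n: "n \<ge> 3" and C: "C \<in> partition_complex n"
    and Q: "Q \<in> C" "completes n Q C" and Q': "Q' \<in> C" "completes n Q' C"
  shows "Q = Q'"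
proof -
  have C': "C \<in> insert {} (partition_complex n)" using C by simp
  have eq: "Q2 = Q1" if Q12: "Q1 \<in> C" "Q2 \<in> C" "completes n Q1 C" "small Q2" "refines {1..n} Q1 Q2" for Q1 Q2
  proof -
    obtain P where P: "P \<in> insert {{1..n}} C" "\<not> small P" "full Q1 P"
      using Q12(3) by (auto simp: completes_def)
    then have "refines {1..n} Q2 P"
      using small_refines_not_small[OF n C'] Q12 by blast
    then show ?thesis
      using full_maximal[OF _ P(3)] Q12 by blast
  qed
  have "small Q" "small Q'" using Q Q' by (auto simp: completes_def)
  then show ?thesis
    using eq Q Q' partition_complexD(3)[OF C'] by metis
qed

text \<open>This reduces to \<open>full_unique_up_to_perm\<close> for the finest non-small
  \<open>R\<close>. A small element of \<open>C\<close> refines both completions: if it were coarser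
  than one of them, it would equal it by \<open>full_maximal\<close>.\<close>

lemma completes_unique_up_to_perm:
  assumes n: "n \<ge> 3" and C: "C \<in> insert {} (partition_complex n)"
    and Q: "insert Q C \<in> partition_complex n" "completes n Q C"
    and Q': "insert Q' C \<in> partition_complex n" "completes n Q' C"
  shows "orb n (insert Q C) = orb n (insert Q' C)"
proof -
  obtain R where R: "R \<in> insert {{1..n}} C" "\<not> small R"
    "\<And>P. P \<in> insert {{1..n}} C \<Longrightarrow> \<not> small P \<Longrightarrow> refines {1..n} R P"
    using least_not_small[OF n C] by metis
  have below: "refines {1..n} Q R" "small Q" "full Q R"
    if Q: "insert Q C \<in> partition_complex n" "completes n Q C" for Q
  proof -
    show "small Q" using Q by (simp add: completes_def)
    have "insert Q C \<in> insert {} (partition_complex n)" using Q(1) by simp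
    from small_refines_not_small[OF n this] show "refines {1..n} Q R"
      using R(1,2) \<open>small Q\<close> by blast
    obtain P where P: "P \<in> insert {{1..n}} C" "\<not> small P" "full Q P"
      using Q(2) by (auto simp: completes_def)
    show "full Q R"
      using full_refines[OF R(3)[OF P(1,2)] P(3)] .
  qed
  have "refines {1..n} T Q \<and> refines {1..n} T Q' \<or> refines {1..n} R T" if T: "T \<in> C" for T
  proof (cases "small T")
    case True
    have "refines {1..n} T Q" if Q: "insert Q C \<in> partition_complex n" "completes n Q C" for Q
    proof -
      have C': "insert Q C \<in> insert {} (partition_complex n)" using Q(1) by simp
      consider "refines {1..n} T Q" | "refines {1..n} Q T"
        using partition_complexD(3)[OF C'] T by blast
      then show ?thesis
      proof cases
        case 2
        have "refines {1..n} T R"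
          using small_refines_not_small[OF n C _ True R(1,2)] T by blast
        then have "T = Q"
          using full_maximal[OF _ below(3)[OF Q] 2 _ True] by blast
        then show ?thesis using 2 by blast
      qed
    qed
    then show ?thesis using Q Q' by blast
  next
    case False
    then show ?thesis using R(3) T by blast
  qed
  then obtain p where p: "p permutes {1..n}" "\<forall>T\<in>C. perm_partition p T = T" "perm_partition p Q = Q'"
    using full_unique_up_to_perm[OF _ below[OF Q] below[OF Q'], of C] by blast
  then have "insert Q' C = perm_partition p ` insert Q C" by auto
  then show ?thesis
    unfolding orb_eq_iff using p(1) by blast
qed

text \<open>
  The sum of the two numbers suffices as a rank: passing from a chain to a larger one and then
  removing one small element cannot lower the size.
\<close>
definition rank :: "nat set set set \<Rightarrow> nat" where
  "rank C = card {P \<in> C. \<not> small P} + card C"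

lemma rank_perm:
  assumes p: "p permutes {1..n}"
  shows "rank (perm_partition p ` C) = rank C"
proof -
  have inj: "inj_on (perm_partition p) X" for X
    using inj_perm_partition[OF p] by (rule inj_on_subset) simp
  have "{P \<in> perm_partition p ` C. \<not> small P} = perm_partition p ` {P \<in> C. \<not> small P}"
    using small_perm_partition[OF p] by auto
  then show ?thesis
    by (simp add: rank_def card_image[OF inj])
qed

lemma rank_strict_mono:
  assumes "C \<subset> E" "finite E"
  shows "rank C < rank E"
proof -
  have "card {P \<in> C. \<not> small P} \<le> card {P \<in> E. \<not> small P}"
    using assms by (intro card_mono) auto
  moreover have "card C < card E"
    using assms psubset_card_mono by blast
  ultimately show ?thesis by (simp add: rank_def)
qed

text \<open>The empty chain is not in \<open>partition_complex\<close>, so its pair is left out here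
  and its partner remains unmatched.\<close>

definition completions :: "nat \<Rightarrow> (nat set set set \<times> nat set set) set" where
  "completions n = {(C, Q). C \<in> partition_complex n \<and> insert Q C \<in> partition_complex n \<and>
     Q \<notin> C \<and> completes n Q C}"

section \<open>Compatibility of the matching with orbits, and its acyclicity\<close>

lemma completions_Diff:
  assumes "E \<in> partition_complex n" "Q \<in> E" "completes n Q E" "E \<noteq> {Q}"
  shows "(E - {Q}, Q) \<in> completions n" "insert Q (E - {Q}) = E"
proof -
  show eq: "insert Q (E - {Q}) = E" using assms by blast
  have "E - {Q} \<in> partition_complex n"
    using assms partition_complex_subset[of E n "E - {Q}"] by blast
  then show "(E - {Q}, Q) \<in> completions n"
    using assms eq completes_insert_self[of n Q "E - {Q}"] by (simp add: completions_def)
qed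

text \<open>This separates lower from upper members of pairs. Completing elements persist in larger
  chains, so \<open>Q'\<close> and \<open>Q\<close> would both complete \<open>insert Q C\<close>
  and hence coincide.\<close>

lemma completions_not_completed:
  assumes n: "n \<ge> 3" and CQ: "(C, Q) \<in> completions n" and Q': "Q' \<in> C"
  shows "\<not> completes n Q' C"
proof
  assume "completes n Q' C"
  then have "completes n Q' (insert Q C)" by (rule completes_insert)
  moreover have "completes n Q (insert Q C)"
    using CQ completes_insert by (auto simp: completions_def)
  ultimately have "Q = Q'"
    using completes_unique[OF n, of "insert Q C"] CQ Q' by (auto simp: completions_def)
  then show False using CQ Q' by (auto simp: completions_def)
qed

text \<open>The core of acyclicity. If \<open>Q'\<close> is not in \<open>C\<close>, then
  \<open>C\<close> is a proper subset of \<open>E - {Q'}\<close>. Otherwise \<open>Q'\<close> does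
  not complete \<open>C\<close>, so the non-small partition in which \<open>Q'\<close> is full lies
  in \<open>E\<close> but not in \<open>C\<close>. The number of non-small elements then grows,
  while the size does not drop.\<close>

lemma rank_less_Diff:
  assumes n: "n \<ge> 3" and CQ: "(C, Q) \<in> completions n"
    and E: "E \<in> partition_complex n" "C \<subseteq> E" "Q' \<in> E" "completes n Q' E" "E - {Q'} \<noteq> C"
  shows "rank C < rank (E - {Q'})"
proof -
  have fin: "finite E" using E(1) by (simp add: order_complex_def)
  show ?thesis
  proof (cases "Q' \<in> C")
    case False
    then show ?thesis
      using E fin by (intro rank_strict_mono) auto
  next
    case True
    then have not: "\<not> completes n Q' C"
      using completions_not_completed[OF n CQ] by blast
    obtain P where P: "P \<in> insert {{1..n}} E" "\<not> small P" "full Q' P" and small: "small Q'"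
      using E(4) by (auto simp: completes_def)
    have "P \<in> E - C"
      using not P small by (auto simp: completes_def)
    then have "{T \<in> C. \<not> small T} \<subset> {T \<in> E - {Q'}. \<not> small T}"
      using E(2) P small by blast
    then have "card {T \<in> C. \<not> small T} < card {T \<in> E - {Q'}. \<not> small T}"
      using fin by (intro psubset_card_mono) auto
    moreover have "card C < card E"
      using \<open>P \<in> E - C\<close> E(2) fin by (intro psubset_card_mono) auto
    ultimately show ?thesis
      using E(3) fin by (simp add: rank_def)
  qed
qed

text \<open>A permutation from \<open>C\<close> to \<open>C'\<close> transports \<open>Q\<close> to
  a second completion of \<open>C'\<close>, and completions of one chain agree up to orbit.\<close>

lemma completions_orb_cong:
  assumes n: "n \<ge> 3" and CQ: "(C, Q) \<in> completions n" "(C', Q') \<in> completions n"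
    and eq: "orb n C = orb n C'"
  shows "orb n (insert Q C) = orb n (insert Q' C')"
proof -
  obtain p where p: "p permutes {1..n}" "C' = perm_partition p ` C"
    using eq by (rule orb_eqE)
  have "insert (perm_partition p Q) C' \<in> partition_complex n"
    using CQ(1) p perm_partition_complex[of p n "insert Q C"] by (simp add: completions_def sym_group_carrier)
  moreover have "completes n (perm_partition p Q) C'"
    using CQ(1) completes_perm p by (simp add: completions_def)
  ultimately have "orb n (insert (perm_partition p Q) C') = orb n (insert Q' C')"
    using CQ(2) by (intro completes_unique_up_to_perm[OF n]) (auto simp: completions_def)
  then show ?thesis
    using orb_perm[OF p(1), of "insert Q C"] p(2) by simp
qed

text \<open>A permutation between the upper chains must carry \<open>Q\<close> to \<open>Q'\<close>,
  as each chain has only one completing element. Removing these leaves \<open>C\<close> and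
  \<open>C'\<close>.\<close>

lemma completions_orb_inj:
  assumes n: "n \<ge> 3" and CQ: "(C, Q) \<in> completions n" "(C', Q') \<in> completions n"
    and eq: "orb n (insert Q C) = orb n (insert Q' C')"
  shows "orb n C = orb n C'"
proof -
  obtain p where p: "p permutes {1..n}" "insert Q' C' = perm_partition p ` insert Q C"
    using eq by (rule orb_eqE)
  have C: "completes n Q (insert Q C)" "completes n Q' (insert Q' C')" "insert Q' C' \<in> partition_complex n"
    using CQ completes_insert by (auto simp: completions_def)
  have "completes n (perm_partition p Q) (insert Q' C')"
    using completes_perm[OF p(1) C(1)] p(2) by simp
  then have Q: "perm_partition p Q = Q'"
    using completes_unique[OF n C(3)] C(2) p(2) by blast
  have "Q' \<notin> perm_partition p ` C"
    using CQ(1) Q inj_image_mem_iff[OF inj_perm_partition[OF p(1)]] by (auto simp: completions_def)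
  moreover have "Q' \<notin> C'" "insert Q' C' = insert Q' (perm_partition p ` C)"
    using CQ(2) p(2) Q by (auto simp: completions_def)
  ultimately have "C' = perm_partition p ` C"
    by (metis Diff_insert_absorb)
  then show ?thesis
    unfolding orb_eq_iff using p(1) by blast
qed

text \<open>Containing a completing element is invariant under permutations, and the lower chain of
  a pair contains none.\<close>

lemma completions_orb_neq:
  assumes n: "n \<ge> 3" and CQ: "(C, Q) \<in> completions n" and Q': "Q' \<in> C'" "completes n Q' C'"
  shows "orb n C \<noteq> orb n C'"
proof
  assume "orb n C = orb n C'"
  then have "orb n C' = orb n C" by (rule sym)
  then obtain p where p: "p permutes {1..n}" "C = perm_partition p ` C'"
    by (rule orb_eqE)
  then show False
    using completions_not_completed[OF n CQ] completes_perm[OF p(1) Q'(2)] Q'(1) by blast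
qed

section \<open>The collapse of the quotient complex\<close>

theorem mainTheorem8:
  fixes n :: nat
  assumes "n \<ge> 3"
  shows "collapsible (partition_complex_quotient n)"
proof -
  note n = assms
  define K where "K = partition_complex_quotient n"
  let ?D = "partition_complex n"
  define M where "M = (\<lambda>(C, Q). (orb n C, orb n (insert Q C))) ` completions n"
  \<comment> \<open>\<open>Q0\<close> is the partner of the empty chain, a maximum matching of the
    whole set. The orbit of \<open>{Q0}\<close> is the point that remains.\<close>
  obtain Q0 where Q0: "completes n Q0 {}" "{Q0} \<in> ?D"
    using ex_completes[OF n, of "{}"] by auto
  let ?v = "orb n {Q0}"
  have cells: "cells K = orb n ` ?D"
    by (auto simp: K_def quotient_complex_def orbits_def)
  have face: "face K s t \<longleftrightarrow> (\<exists>\<sigma>\<in>s. \<exists>\<tau>\<in>t. \<sigma> \<subseteq> \<tau>)" for s t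
    by (simp add: K_def quotient_complex_def)
  have dim: "cell_dim K (orb n C) = card C - 1" if "C \<in> ?D" for C
    unfolding K_def using that by (rule cell_dim_partition_complex_quotient)
  \<comment> \<open>By \<open>rank_perm\<close> the rank is constant on orbits, so the choice of
    representative is immaterial.\<close>
  define r where "r s = rank (SOME C. C \<in> s)" for s
  have r: "r (orb n C) = rank C" for C
  proof -
    have "(SOME E. E \<in> orb n C) \<in> orb n C"
      using orb_refl by (rule someI)
    then show ?thesis
      unfolding r_def using rank_perm by (auto simp: orb_iff)
  qed
  have MI: "(orb n C, orb n (insert Q C)) \<in> M" if "(C, Q) \<in> completions n" for C Q
    using that by (force simp: M_def)
  have MD: "\<exists>C Q. (C, Q) \<in> completions n \<and> s = orb n C \<and> t = orb n (insert Q C)" if "(s, t) \<in> M" for s t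
    using that by (auto simp: M_def)
  have "collapsible K"
  proof (rule collapsible_if_acyclic_matching)
    have "finite (proper_partitions n)"
      using finitely_many_partition_on[of "{1..n}"]
      by (rule rev_finite_subset) (auto simp: proper_partitions_def)
    then have "finite ?D"
      by (intro finite_subset[of ?D "Pow (proper_partitions n)"]) (auto simp: order_complex_def)
    then show "finite (cells K)" by (simp add: cells)
    show "?v \<in> cells K" using Q0 by (simp add: cells)
    show "cell_dim K ?v = 0"
      using dim[OF Q0(2)] by simp
    show "?v \<notin> Field M"
    proof
      assume "?v \<in> Field M"
      then obtain C Q where CQ: "(C, Q) \<in> completions n" and "?v = orb n C \<or> ?v = orb n (insert Q C)"
        using MD unfolding Field_def Domain_iff Range_iff by blast
      moreover have "completes n Q0 {Q0}"
        using Q0(1) completes_insert by blast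
      then have "?v \<noteq> orb n C"
        using completions_orb_neq[OF n CQ, of Q0 "{Q0}"] by auto
      ultimately have "?v = orb n (insert Q C)" by blast
      then obtain p where "insert Q C = perm_partition p ` {Q0}"
        by (rule orb_eqE)
      \<comment> \<open>An upper chain has at least two elements, as \<open>C\<close> is nonempty
        and \<open>Q\<close> is not in it.\<close>
      then show False
        using CQ by (auto simp: completions_def order_complex_def)
    qed
    show "cells K = insert ?v (Field M)"
    proof
      show "cells K \<subseteq> insert ?v (Field M)"
      proof
        fix u assume "u \<in> cells K"
        then obtain C where C: "C \<in> ?D" "u = orb n C" by (auto simp: cells)
        show "u \<in> insert ?v (Field M)"
        proof (cases "\<exists>Q\<in>C. completes n Q C")
          case True
          then obtain Q where Q: "Q \<in> C" "completes n Q C" by blast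
          show ?thesis
          proof (cases "C = {Q}")
            case True
            \<comment> \<open>Removing \<open>Q\<close> leaves the empty chain, so \<open>Q\<close>
              is one of its completions and has the same orbit as \<open>Q0\<close>.\<close>
            then have "completes n Q {}" using Q completes_insert_self by blast
            then have "orb n {Q} = ?v"
              using C(1) True Q0 by (intro completes_unique_up_to_perm[OF n]) auto
            then have "u = ?v"
              using C(2) True by simp
            then show ?thesis by simp
          next
            case False
            then show ?thesis
              using MI[OF completions_Diff(1)[OF C(1) Q]] completions_Diff(2)[OF C(1) Q] C(2)
              by (simp add: FieldI2)
          qed
        next
          case False
          then obtain Q where "(C, Q) \<in> completions n"
            using ex_completes[OF n, of C] C(1) by (auto simp: completions_def)
          then show ?thesis using MI C(2) by (auto intro: FieldI1)
        qed
      qed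
      show "insert ?v (Field M) \<subseteq> cells K"
        using Q0(2) by (auto simp: cells M_def Field_def completions_def)
    qed
    show "face K s t \<and> cell_dim K t = Suc (cell_dim K s)" if st: "(s, t) \<in> M" for s t
    proof -
      obtain C Q where CQ: "(C, Q) \<in> completions n" "s = orb n C" "t = orb n (insert Q C)"
        using MD[OF st] by blast
      then have C: "C \<in> ?D" "insert Q C \<in> ?D" "Q \<notin> C" by (auto simp: completions_def)
      then have "finite C" "C \<noteq> {}" by (auto simp: order_complex_def)
      then have "card (insert Q C) - 1 = Suc (card C - 1)"
        using C(3) by (simp add: card_gt_0_iff)
      moreover have "face K s t"
        unfolding face CQ(2,3) using orb_refl by blast
      ultimately show ?thesis
        by (simp add: CQ(2,3) dim[OF C(1)] dim[OF C(2)])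
    qed
    show "s = s' \<and> t = t'" if st: "(s, t) \<in> M" "(s', t') \<in> M" "{s, t} \<inter> {s', t'} \<noteq> {}" for s t s' t'
    proof -
      obtain C Q where CQ: "(C, Q) \<in> completions n" "s = orb n C" "t = orb n (insert Q C)"
        using MD[OF st(1)] by blast
      obtain C' Q' where CQ': "(C', Q') \<in> completions n" "s' = orb n C'" "t' = orb n (insert Q' C')"
        using MD[OF st(2)] by blast
      have compl: "completes n Q (insert Q C)" "completes n Q' (insert Q' C')"
        using CQ CQ' completes_insert by (auto simp: completions_def)
      then have "s \<noteq> t'" "s' \<noteq> t"
        using completions_orb_neq[OF n] CQ CQ' by blast+
      then have "s = s' \<or> t = t'" using st(3) by blast
      then show ?thesis
        using completions_orb_cong[OF n CQ(1) CQ'(1)] completions_orb_inj[OF n CQ(1) CQ'(1)]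
        unfolding CQ(2,3) CQ'(2,3) by blast
    qed
    show "u = s \<or> u = t \<or> (\<exists>s' t'. (s', t') \<in> M \<and> u \<in> {s', t'} \<and> r s < r s')"
      if st: "(s, t) \<in> M" and u: "u \<in> cells K" "face K s u" for s t u
    proof -
      obtain \<sigma> \<tau> where st': "\<sigma> \<in> s" "\<tau> \<in> u" "\<sigma> \<subseteq> \<tau>"
        using u(2) face by blast
      obtain C Q where CQ: "(C, Q) \<in> completions n" "s = orb n C" "t = orb n (insert Q C)"
        using MD[OF st] by blast
      obtain p where p: "p permutes {1..n}" "\<sigma> = perm_partition p ` C"
        using st'(1) CQ(2) orb_iff by blast
      \<comment> \<open>Moving \<tau> back by the inverse of \<open>p\<close> gives a representative
        of \<open>u\<close> that contains \<open>C\<close> itself, so chains can be compared instead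
        of orbits.\<close>
      define E where "E = perm_partition (inv_into UNIV p) ` \<tau>"
      have p': "inv_into UNIV p permutes {1..n}" using p(1) by (rule permutes_inv)
      obtain F q where F: "F \<in> ?D" "u = orb n F" "q permutes {1..n}" "\<tau> = perm_partition q ` F"
        using u(1) st'(2) by (auto simp: cells orb_iff)
      have uE: "u = orb n E"
        unfolding E_def F(4) orb_perm[OF p'] orb_perm[OF F(3)] F(2) by (rule refl)
      have E: "E \<in> ?D"
        unfolding E_def F(4) using F(1,3) p' by (intro perm_partition_complex) (auto simp: sym_group_carrier)
      have "perm_partition (inv_into UNIV p) ` \<sigma> = C"
        unfolding p(2) by (simp add: image_image perm_partition_inverse[OF p(1)])
      then have CE: "C \<subseteq> E"
        using st'(3) unfolding E_def by blast
      have C: "C \<in> ?D" "C \<noteq> {}" and finE: "finite E"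
        using CQ(1) E by (auto simp: completions_def order_complex_def)
      show ?thesis
      \<comment> \<open>Without a completing element \<open>E\<close> is a lower chain and its own
        rank counts; with one it is an upper chain and the rank of \<open>E - {Q'}\<close>
        counts.\<close>
      proof (cases "\<exists>Q'\<in>E. completes n Q' E")
        case False
        then obtain Q' where Q': "(E, Q') \<in> completions n"
          using ex_completes[OF n, of E] E by (auto simp: completions_def)
        show ?thesis
        proof (cases "E = C")
          case True
          then show ?thesis using uE CQ(2) by simp
        next
          case False
          then have "rank C < rank E" using rank_strict_mono CE finE by blast
          then have "r s < r u" by (simp add: r uE CQ(2))
          then show ?thesis using MI[OF Q'] unfolding uE by blast
        qed
      next
        case True
        then obtain Q' where Q': "Q' \<in> E" "completes n Q' E" by blast
        have "E \<noteq> {Q'}"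
        proof
          assume "E = {Q'}"
          then have "E = C" using CE C(2) by blast
          then show False using completions_not_completed[OF n CQ(1)] Q' by blast
        qed
        note diff = completions_Diff[OF E Q' this]
        show ?thesis
        proof (cases "E - {Q'} = C")
          case True
          \<comment> \<open>Both \<open>Q'\<close> and \<open>Q\<close> complete \<open>C\<close>,
            so the two upper chains have the same orbit.\<close>
          then have "u = t"
            using completions_orb_cong[OF n diff(1) CQ(1)] diff(2) uE CQ(3) by simp
          then show ?thesis by simp
        next
          case False
          then have "rank C < rank (E - {Q'})"
            using rank_less_Diff[OF n CQ(1) E CE Q'] by blast
          then have "r s < r (orb n (E - {Q'}))" by (simp only: r CQ(2))
          moreover have "(orb n (E - {Q'}), u) \<in> M"
            using MI[OF diff(1)] by (simp only: diff(2) uE)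
          ultimately show ?thesis by blast
        qed
      qed
    qed
  qed
  then show ?thesis by (simp only: K_def)
qed

end
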